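(* For every integer $r \ge 5$, there exists a graph $F_r$ such that $\mathrm{sat}(n, C_r, F_r) = 0$ for infinitely many values of $n$ and $\mathrm{sat}(n, C_r, F_r) > 0$ for infinitely many values of $n$.
   Context: A graph $G$ is $F$-saturated if $G$ contains no copy of $F$ but adding any edge to $G$ creates a copy of $F$. $\mathrm{sat}(n,H,F)$ is the minimum number of copies of $H$ in an $n$-vertex $F$-saturated graph. $C_r$ is the cycle of length $r$. *)

theory Defs
  imports Main
begin

text \<open>Finite simple graphs, as a vertex set together with a set of two-element edges.\<close>

type_synonym 'a ugraph = "'a set \<times> 'a set set"

abbreviation verts :: "'a ugraph \<Rightarrow> 'a set" where "verts \<equiv> fst"
abbreviation edges :: "'a ugraph \<Rightarrow> 'a set set" where "edges \<equiv> snd"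

definition simple_graph :: "'a ugraph \<Rightarrow> bool" where
  "simple_graph G \<longleftrightarrow> finite (verts G) \<and> (\<forall>e\<in>edges G. e \<subseteq> verts G \<and> card e = 2)"

definition subgraph :: "'a ugraph \<Rightarrow> 'a ugraph \<Rightarrow> bool" where
  "subgraph K G \<longleftrightarrow> simple_graph K \<and> verts K \<subseteq> verts G \<and> edges K \<subseteq> edges G"

definition isomorphic :: "'a ugraph \<Rightarrow> 'b ugraph \<Rightarrow> bool" where
  "isomorphic H K \<longleftrightarrow> (\<exists>f. bij_betw f (verts H) (verts K) \<and> edges K = (\<lambda>e. f ` e) ` edges H)"

text \<open>A copy of \<open>H\<close> in \<open>G\<close> is a (not necessarily induced) subgraph of \<open>G\<close> isomorphic to \<open>H\<close>;
  copies are counted as subgraphs, not as embeddings.\<close>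

definition copies :: "'a ugraph \<Rightarrow> 'b ugraph \<Rightarrow> 'b ugraph set" where
  "copies H G = {K. subgraph K G \<and> isomorphic H K}"

definition add_edge :: "'a \<Rightarrow> 'a \<Rightarrow> 'a ugraph \<Rightarrow> 'a ugraph" where
  "add_edge u v G = (verts G, insert {u, v} (edges G))"

definition saturated :: "'a ugraph \<Rightarrow> 'b ugraph \<Rightarrow> bool" where
  "saturated F G \<longleftrightarrow> simple_graph G \<and> copies F G = {} \<and>
     (\<forall>u\<in>verts G. \<forall>v\<in>verts G. u \<noteq> v \<and> {u, v} \<notin> edges G \<longrightarrow> copies F (add_edge u v G) \<noteq> {})"

text \<open>Every finite graph is isomorphic to one with vertices in \<^typ>\<open>nat\<close>, so it suffices to let the
  \<open>n\<close>-vertex host graph range over those. The infimum is a minimum whenever \<open>F\<close> has an edge, by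
  \<open>saturated_exists\<close> below; on an empty set of values it is \<open>0\<close>.\<close>

definition sat :: "nat \<Rightarrow> 'a ugraph \<Rightarrow> 'b ugraph \<Rightarrow> nat" where
  "sat n H F = Inf {card (copies H G) | G :: nat ugraph. saturated F G \<and> card (verts G) = n}"

definition cycle :: "nat \<Rightarrow> nat ugraph" where
  "cycle r = ({..<r}, {{i, (i + 1) mod r} | i. i < r})"

lemma saturated_exists:
  fixes F :: "'a ugraph"
  assumes "edges F \<noteq> {}"
  shows "\<exists>G :: nat ugraph. saturated F G \<and> card (verts G) = n"
proof -
  let ?P = "{e. e \<subseteq> {..<n} \<and> card e = 2}"
  let ?S = "{E. E \<subseteq> ?P \<and> copies F ({..<n}, E) = {}}"
  have "finite ?S"
    by (rule finite_subset[of _ "Pow (Pow {..<n})"]) auto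
  moreover have "{} \<in> ?S"
    using assms by (auto simp: copies_def subgraph_def isomorphic_def)
  ultimately obtain E where E: "E \<in> ?S" and max: "\<And>E'. E' \<in> ?S \<Longrightarrow> E \<subseteq> E' \<Longrightarrow> E' = E"
    using finite_has_maximal[of ?S] by (metis (no_types, lifting) empty_iff)
  have "copies F (add_edge u v ({..<n}, E)) \<noteq> {}"
    if "u < n" "v < n" "u \<noteq> v" "{u, v} \<notin> E" for u v
  proof
    assume "copies F (add_edge u v ({..<n}, E)) = {}"
    with that E have "insert {u, v} E \<in> ?S"
      by (auto simp: add_edge_def)
    from max[OF this] that show False by blast
  qed
  with E have "saturated F ({..<n}, E)"
    by (auto simp: saturated_def simple_graph_def)
  then show ?thesis by (intro exI[of _ "({..<n}, E)"]) simp
qed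

lemma sat_attained:
  fixes H :: "'a ugraph" and F :: "'b ugraph"
  assumes "edges F \<noteq> {}"
  shows "\<exists>G :: nat ugraph. saturated F G \<and> card (verts G) = n \<and> card (copies H G) = sat n H F"
proof -
  let ?A = "{card (copies H G) | G :: nat ugraph. saturated F G \<and> card (verts G) = n}"
  have "?A \<noteq> {}" using saturated_exists[OF assms, of n] by blast
  then have "Inf ?A \<in> ?A" by (rule Inf_nat_def1)
  then show ?thesis unfolding sat_def by force
qed

end

theory Submission
  imports Defs
begin

text \<open>Put \<open>k = r - 1\<close> and let \<open>F\<close> be two disjoint copies of \<open>K\<^sub>k\<close> joined by an edge. If \<open>k\<close> divides
  \<open>n\<close>, then a disjoint union of copies of \<open>K\<^sub>k\<close> is \<open>F\<close>-saturated and has no cycle of length \<open>k + 1\<close>.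
  Conversely, let \<open>G\<close> be \<open>F\<close>-saturated without such a cycle, on at least \<open>k\<close> vertices. A missing edge
  \<open>uv\<close> of \<open>G\<close> either joins two disjoint \<open>k\<close>-cliques, or \<open>u\<close> and \<open>v\<close> have \<open>k - 2 \<ge> 2\<close> common
  neighbours. As a short path outside a \<open>k\<close>-clique connecting two of its vertices closes up to a
  cycle of length \<open>k + 1\<close>, this forces the \<open>k\<close>-cliques of \<open>G\<close> to partition its vertices, so \<open>k\<close>
  divides \<open>n\<close>.\<close>

section \<open>Copies as embeddings\<close>

text \<open>An embedding carries \<open>H\<close> onto a subgraph of the host, and injectivity keeps
  the images of edges two-element. Only the existence of copies matters below, so embeddings replace
  subgraphs from here on.\<close>

lemma copies_nonempty_iff:
  assumes "simple_graph H"
  shows "copies H G \<noteq> {} \<longleftrightarrow>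
    (\<exists>f. inj_on f (verts H) \<and> f ` verts H \<subseteq> verts G \<and> (\<forall>e\<in>edges H. f ` e \<in> edges G))"
proof
  assume "copies H G \<noteq> {}"
  then obtain K f where "subgraph K G" "bij_betw f (verts H) (verts K)"
    "edges K = (\<lambda>e. f ` e) ` edges H"
    by (auto simp: copies_def isomorphic_def)
  then show "\<exists>f. inj_on f (verts H) \<and> f ` verts H \<subseteq> verts G \<and> (\<forall>e\<in>edges H. f ` e \<in> edges G)"
    by (intro exI[of _ f]) (auto simp: subgraph_def bij_betw_def)
next
  assume "\<exists>f. inj_on f (verts H) \<and> f ` verts H \<subseteq> verts G \<and> (\<forall>e\<in>edges H. f ` e \<in> edges G)"
  then obtain f where f: "inj_on f (verts H)" "f ` verts H \<subseteq> verts G"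
    "\<forall>e\<in>edges H. f ` e \<in> edges G" by blast
  let ?K = "(f ` verts H, (\<lambda>e. f ` e) ` edges H)"
  have "card (f ` e) = 2" if "e \<in> edges H" for e
    using assms that f(1) by (metis card_image inj_on_subset simple_graph_def)
  then have "simple_graph ?K"
    using assms by (auto simp: simple_graph_def)
  then have "?K \<in> copies H G"
    using f by (auto simp: copies_def subgraph_def isomorphic_def bij_betw_def)
  then show "copies H G \<noteq> {}" by blast
qed

text \<open>Needed because \<open>card\<close> of an infinite set is 0: with finiteness, a count of
  0 really means that there is no copy.\<close>

lemma finite_copies:
  assumes "simple_graph G"
  shows "finite (copies H G)"
proof (rule finite_subset)
  show "copies H G \<subseteq> Pow (verts G) \<times> Pow (Pow (verts G))"
    using assms by (fastforce simp: copies_def subgraph_def simple_graph_def)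
  show "finite (Pow (verts G) \<times> Pow (Pow (verts G)))"
    using assms by (simp add: simple_graph_def)
qed

lemma simple_graph_cycle:
  assumes "r \<ge> 3"
  shows "simple_graph (cycle r)"
proof -
  have "i \<noteq> (i + 1) mod r" if "i < r" for i
    using that assms by (cases "i + 1 = r") auto
  then show ?thesis
    using assms by (auto simp: simple_graph_def cycle_def card_2_iff)
qed

text \<open>Repeating the head at the end turns the closing edge of the cycle into one more
  consecutive pair, and \<open>xs ! i\<close> is then the embedding. Only the index
  \<open>r - 1\<close>, where \<open>mod\<close> wraps around, needs separate care.\<close>

lemma cycle_copy_of_list:
  assumes "r \<ge> 3" "length xs = r" "distinct xs" "set xs \<subseteq> verts G"
    and succ: "successively (\<lambda>x y. {x, y} \<in> edges G) (xs @ [hd xs])"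
  shows "copies (cycle r) G \<noteq> {}"
proof -
  have "{xs ! i, xs ! ((i + 1) mod r)} \<in> edges G" if "i < r" for i
  proof -
    have *: "{(xs @ [hd xs]) ! i, (xs @ [hd xs]) ! Suc i} \<in> edges G"
      using succ that assms(2) by (simp add: successively_conv_nth)
    show ?thesis
    proof (cases "Suc i = r")
      case True
      moreover have "xs \<noteq> []" using assms by auto
      ultimately show ?thesis
        using * assms(2) that by (simp add: nth_append hd_conv_nth)
    next
      case False
      then show ?thesis using * assms(2) that by (simp add: nth_append)
    qed
  qed
  then have "inj_on (\<lambda>i. xs ! i) (verts (cycle r)) \<and> (\<lambda>i. xs ! i) ` verts (cycle r) \<subseteq> verts G \<and>
    (\<forall>e\<in>edges (cycle r). (\<lambda>i. xs ! i) ` e \<in> edges G)"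
    using assms(2-4) by (auto simp: cycle_def inj_on_nth)
  then show ?thesis
    unfolding copies_nonempty_iff[OF simple_graph_cycle[OF assms(1)]] by blast
qed

section \<open>Cliques and dumbbells\<close>

definition clique :: "'a ugraph \<Rightarrow> nat \<Rightarrow> 'a set \<Rightarrow> bool" where
  "clique G k P \<longleftrightarrow> P \<subseteq> verts G \<and> finite P \<and> card P = k \<and>
     (\<forall>x\<in>P. \<forall>y\<in>P. x \<noteq> y \<longrightarrow> {x, y} \<in> edges G)"

definition dumbbell :: "nat \<Rightarrow> nat ugraph" where
  "dumbbell k = ({..<2 * k}, insert {0, k} {e. card e = 2 \<and> (e \<subseteq> {..<k} \<or> e \<subseteq> {k..<2 * k})})"

lemma simple_graph_dumbbell:
  assumes "k > 0"
  shows "simple_graph (dumbbell k)"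
  using assms by (auto simp: simple_graph_def dumbbell_def)

text \<open>Used to enumerate a clique so that the bridge end of the dumbbell lands on a prescribed
  vertex.\<close>

lemma ex_bij_betw_pointed:
  assumes "finite A" "finite B" "card A = card B" "a \<in> A" "b \<in> B"
  shows "\<exists>f. bij_betw f A B \<and> f a = b"
proof -
  have "card (A - {a}) = card (B - {b})" using assms by simp
  then obtain f where f: "bij_betw f (A - {a}) (B - {b})"
    using assms by (meson finite_Diff finite_same_card_bij)
  have "bij_betw (f(a := b)) (A - {a}) (B - {b})"
    using f by (rule bij_betw_cong[THEN iffD1, rotated]) auto
  then have "bij_betw (f(a := b)) (A - {a} \<union> {a}) (B - {b} \<union> {b})"
    using notIn_Un_bij_betw[of a "A - {a}" "f(a := b)" "B - {b}"] by simp
  then show ?thesis using assms by (intro exI[of _ "f(a := b)"]) (simp add: insert_absorb)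
qed

text \<open>All vertices of a complete block are interchangeable, so the bridge may end anywhere in
  the two cliques.\<close>

lemma dumbbell_copies_iff:
  assumes "k > 0"
  shows "copies (dumbbell k) G \<noteq> {} \<longleftrightarrow>
    (\<exists>P Q p q. clique G k P \<and> clique G k Q \<and> P \<inter> Q = {} \<and> p \<in> P \<and> q \<in> Q \<and> {p, q} \<in> edges G)"
    (is "_ \<longleftrightarrow> ?R")
proof
  assume "copies (dumbbell k) G \<noteq> {}"
  moreover have "verts (dumbbell k) = {..<2 * k}" by (simp add: dumbbell_def)
  ultimately obtain f where f: "inj_on f {..<2 * k}" "f ` {..<2 * k} \<subseteq> verts G"
    "\<And>e. e \<in> edges (dumbbell k) \<Longrightarrow> f ` e \<in> edges G"
    unfolding copies_nonempty_iff[OF simple_graph_dumbbell[OF assms]]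
    by auto
  have cl: "clique G k (f ` A)" if A: "A = {..<k} \<or> A = {k..<2 * k}" for A
  proof -
    have sub: "A \<subseteq> {..<2 * k}" and "card A = k" "finite A" using A by auto
    have "{f x, f y} \<in> edges G" if "x \<in> A" "y \<in> A" "f x \<noteq> f y" for x y
    proof -
      have "{x, y} \<in> edges (dumbbell k)"
        using that A by (auto simp: dumbbell_def card_2_iff)
      then show ?thesis using f(3) by fastforce
    qed
    moreover have "card (f ` A) = k"
      using sub \<open>card A = k\<close> f(1) by (metis card_image inj_on_subset)
    moreover have "f ` A \<subseteq> verts G" using sub f(2) by blast
    ultimately show ?thesis
      using \<open>finite A\<close> unfolding clique_def by blast
  qed
  have "f ` {..<k} \<inter> f ` {k..<2 * k} = f ` ({..<k} \<inter> {k..<2 * k})"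
    by (rule inj_on_image_Int[OF f(1), symmetric]) auto
  then have "f ` {..<k} \<inter> f ` {k..<2 * k} = {}" by auto
  moreover have "{f 0, f k} \<in> edges G"
    using f(3)[of "{0, k}"] by (simp add: dumbbell_def)
  ultimately show ?R
    using cl assms
    by (intro exI[of _ "f ` {..<k}"] exI[of _ "f ` {k..<2 * k}"] exI[of _ "f 0"] exI[of _ "f k"])
      auto
next
  assume ?R
  then obtain P Q p q where PQ: "clique G k P" "clique G k Q" "P \<inter> Q = {}" "p \<in> P" "q \<in> Q"
    "{p, q} \<in> edges G" by blast
  obtain g where g: "bij_betw g {..<k} P" "g 0 = p"
    using ex_bij_betw_pointed[of "{..<k}" P 0 p] PQ assms by (auto simp: clique_def)
  obtain h where h: "bij_betw h {k..<2 * k} Q" "h k = q"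
    using ex_bij_betw_pointed[of "{k..<2 * k}" Q k q] PQ assms by (auto simp: clique_def)
  define f where "f i = (if i < k then g i else h i)" for i
  have fP: "bij_betw f {..<k} P"
    using g(1) by (rule bij_betw_cong[THEN iffD1, rotated]) (simp add: f_def)
  have fQ: "bij_betw f {k..<2 * k} Q"
    using h(1) by (rule bij_betw_cong[THEN iffD1, rotated]) (simp add: f_def)
  have "{..<k} \<union> {k..<2 * k} = {..<2 * k}" by auto
  then have bij: "bij_betw f {..<2 * k} (P \<union> Q)"
    using bij_betw_combine[OF fP fQ PQ(3)] by simp
  have "f ` e \<in> edges G" if e: "e \<in> edges (dumbbell k)" for e
  proof -
    consider "e = {0, k}" | "card e = 2" "e \<subseteq> {..<k} \<or> e \<subseteq> {k..<2 * k}"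
      using e by (auto simp: dumbbell_def)
    then show ?thesis
    proof cases
      case 1
      then show ?thesis using PQ(6) g(2) h(2) assms by (simp add: f_def insert_commute)
    next
      case 2
      then obtain x y where xy: "x \<noteq> y" "e = {x, y}" by (auto simp: card_2_iff)
      have "x \<in> {..<2 * k}" "y \<in> {..<2 * k}" using 2(2) xy(2) by auto
      then have "f x \<noteq> f y" using xy(1) bij by (auto simp: bij_betw_def inj_on_def)
      moreover have "f x \<in> P \<and> f y \<in> P \<or> f x \<in> Q \<and> f y \<in> Q"
        using 2(2) xy(2) fP fQ by (auto simp: bij_betw_def)
      ultimately show ?thesis using xy(2) PQ(1,2) by (auto simp: clique_def)
    qed
  qed
  then have "inj_on f (verts (dumbbell k)) \<and> f ` verts (dumbbell k) \<subseteq> verts G \<and>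
    (\<forall>e\<in>edges (dumbbell k). f ` e \<in> edges G)"
    using bij PQ(1,2) by (auto simp: bij_betw_def dumbbell_def clique_def)
  then show "copies (dumbbell k) G \<noteq> {}"
    unfolding copies_nonempty_iff[OF simple_graph_dumbbell[OF assms]] by blast
qed

section \<open>Cycles of length \<open>k + 1\<close> through a \<open>k\<close>-clique\<close>

lemma successively_clique:
  assumes "clique G k A" "distinct xs" "set xs \<subseteq> A"
  shows "successively (\<lambda>x y. {x, y} \<in> edges G) xs"
  using assms(2,3)
proof (induction xs)
  case (Cons x xs)
  then show ?case using assms(1) by (cases xs) (auto simp: clique_def)
qed simp

text \<open>Inside the clique, a path from \<open>x\<close> to \<open>y\<close> can have any number
  of inner vertices up to \<open>k - 2\<close>. Taking \<open>k - 1 - length ws\<close> of them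
  gives 2 + (k - 1 - length ws) + length ws = k + 1 vertices in total; this choice is possible
  because \<open>ws\<close> has between 1 and \<open>k - 1\<close> entries.\<close>

lemma cycle_of_clique_and_path:
  assumes A: "clique G k A" "x \<in> A" "y \<in> A" "x \<noteq> y"
    and ws: "distinct ws" "set ws \<subseteq> verts G - A" "ws \<noteq> []" "length ws < k"
    and succ: "successively (\<lambda>x y. {x, y} \<in> edges G) (y # ws @ [x])"
  shows "copies (cycle (k + 1)) G \<noteq> {}"
proof -
  have "card (A - {x, y}) = k - 2" using A by (simp add: clique_def card_Diff_subset)
  moreover have "k - 1 - length ws \<le> k - 2" using ws(3) by (cases ws) auto
  ultimately obtain Z where Z: "Z \<subseteq> A - {x, y}" "card Z = k - 1 - length ws" "finite Z"
    by (metis obtain_subset_with_card_n)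
  then obtain zs where zs: "set zs = Z" "distinct zs" "length zs = k - 1 - length ws"
    by (metis finite_distinct_list distinct_card)
  have len: "length (x # zs @ [y] @ ws) = k + 1" using zs(3) ws(4) by simp
  have "successively (\<lambda>x y. {x, y} \<in> edges G) (x # zs @ [y])"
    using successively_clique[OF A(1), of "x # zs @ [y]"] A zs Z by auto
  moreover have "successively (\<lambda>x y. {x, y} \<in> edges G) (ws @ [x])"
    "{y, hd (ws @ [x])} \<in> edges G"
    using succ by (auto simp: successively_Cons)
  ultimately have "successively (\<lambda>x y. {x, y} \<in> edges G) ((x # zs @ [y]) @ (ws @ [x]))"
    by (subst successively_append_iff) simp
  moreover have "length ws > 0" using ws(3) by simp
  then have "k + 1 \<ge> 3" using ws(4) by linarith
  ultimately show ?thesis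
    using A zs Z ws len by (intro cycle_copy_of_list[of _ "x # zs @ [y] @ ws"]) (auto simp: clique_def)
qed

section \<open>Saturated graphs without the cycle\<close>

locale cycle_free_saturated =
  fixes G :: "'a ugraph" and k :: nat
  assumes k: "k \<ge> 4"
    and saturated: "saturated (dumbbell k) G"
    and cycle_free: "copies (cycle (k + 1)) G = {}"
begin

lemma finite_verts: "finite (verts G)"
  using saturated by (simp add: saturated_def simple_graph_def)

lemma edge_verts: "{x, y} \<in> edges G \<Longrightarrow> x \<in> verts G \<and> y \<in> verts G \<and> x \<noteq> y"
  using saturated by (fastforce simp: saturated_def simple_graph_def)

lemma no_dumbbell:
  assumes "clique G k P" "clique G k Q" "p \<in> P" "q \<in> Q" "{p, q} \<in> edges G"
  shows "P \<inter> Q \<noteq> {}"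
proof -
  have "copies (dumbbell k) G = {}" using saturated by (simp add: saturated_def)
  then show ?thesis using assms k dumbbell_copies_iff[of k G] by auto
qed

text \<open>The new dumbbell must use \<open>uv\<close>. If \<open>uv\<close> lies inside one block,
  the other \<open>k - 2\<close> vertices of that block are common neighbours, and the other block,
  being disjoint, is already a clique of \<open>G\<close>; recording it lets both cases supply a
  clique. Otherwise both blocks are old and \<open>uv\<close> is the bridge.\<close>

lemma new_edge_cases:
  assumes "u \<in> verts G" "v \<in> verts G" "u \<noteq> v" "{u, v} \<notin> edges G"
  obtains (bridge) P Q where "clique G k P" "clique G k Q" "P \<inter> Q = {}" "u \<in> P" "v \<in> Q"
  | (common) P where "clique G k P" and
      "\<exists>y z. y \<noteq> z \<and> {u, y} \<in> edges G \<and> {v, y} \<in> edges G \<and> {u, z} \<in> edges G \<and> {v, z} \<in> edges G"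
proof -
  let ?G = "add_edge u v G"
  let ?common = "\<exists>y z. y \<noteq> z \<and> {u, y} \<in> edges G \<and> {v, y} \<in> edges G \<and>
    {u, z} \<in> edges G \<and> {v, z} \<in> edges G"
  have "copies (dumbbell k) ?G \<noteq> {}" using saturated assms by (auto simp: saturated_def)
  then obtain P Q p q where PQ: "clique ?G k P" "clique ?G k Q" "P \<inter> Q = {}" "p \<in> P" "q \<in> Q"
    "{p, q} \<in> edges ?G"
    using k dumbbell_copies_iff[of k ?G] by auto
  have old: "clique G k R" if "clique ?G k R" "\<not> {u, v} \<subseteq> R" for R
    using that by (auto simp: clique_def add_edge_def doubleton_eq_iff)
  have new: ?common if R: "clique ?G k R" "{u, v} \<subseteq> R" for R
  proof -
    have "card (R - {u, v}) = k - 2"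
      using R assms(3) by (simp add: clique_def card_Diff_subset)
    then have "card (R - {u, v}) \<ge> 2" using k by simp
    then obtain Y where "Y \<subseteq> R - {u, v}" "card Y = 2" by (meson obtain_subset_with_card_n)
    then obtain y z where "y \<noteq> z" "{y, z} \<subseteq> R - {u, v}" by (auto simp: card_2_iff)
    then show ?thesis
      using R by (intro exI[of _ y] exI[of _ z]) (auto simp: clique_def add_edge_def doubleton_eq_iff)
  qed
  show thesis
  proof (cases "{u, v} \<subseteq> P \<or> {u, v} \<subseteq> Q")
    case True
    then show thesis
    proof
      assume P: "{u, v} \<subseteq> P"
      then have "clique G k Q" using PQ(3) by (intro old[OF PQ(2)]) blast
      then show thesis using new[OF PQ(1) P] by (rule common)
    next
      assume Q: "{u, v} \<subseteq> Q"
      then have "clique G k P" using PQ(3) by (intro old[OF PQ(1)]) blast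
      then show thesis using new[OF PQ(2) Q] by (rule common)
    qed
  next
    case False
    then have cl: "clique G k P" "clique G k Q" using old PQ by auto
    then have "{p, q} \<notin> edges G" using no_dumbbell PQ by blast
    then have "{p, q} = {u, v}" using PQ(6) by (simp add: add_edge_def)
    \<comment> \<open>The bridge may run from \<open>P\<close> to \<open>Q\<close> in either
      direction, so the two cliques may have to be swapped.\<close>
    then show thesis using bridge[of P Q] bridge[of Q P] cl PQ(3-5) by (auto simp: doubleton_eq_iff)
  qed
qed

text \<open>Two neighbours in the clique would make \<open>w\<close> a one-vertex detour, closing a
  forbidden cycle.\<close>

lemma clique_neighbour_unique:
  assumes "clique G k A" "w \<notin> A" "x \<in> A" "y \<in> A" "{w, x} \<in> edges G" "{w, y} \<in> edges G"
  shows "x = y"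
proof (rule ccontr)
  assume "x \<noteq> y"
  then have "copies (cycle (k + 1)) G \<noteq> {}"
    using assms k edge_verts[OF assms(5)]
    by (intro cycle_of_clique_and_path[of G k A x y "[w]"]) (auto simp: insert_commute)
  then show False using cycle_free by simp
qed

text \<open>If \<open>A\<close> and \<open>B\<close> share \<open>x\<close>, pick \<open>a\<close>
  in \<open>A - B\<close> and \<open>b\<close> in \<open>B - A\<close>. They are not adjacent, since
  \<open>a\<close> already has the neighbour \<open>x\<close> in \<open>B\<close>. Both outcomes of
  adding \<open>ab\<close> are then impossible.\<close>

lemma cliques_disjoint:
  assumes A: "clique G k A" and B: "clique G k B" and "A \<noteq> B"
  shows "A \<inter> B = {}"
proof (rule ccontr)
  assume "A \<inter> B \<noteq> {}"
  then obtain x where x: "x \<in> A" "x \<in> B" by blast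
  have nsub: "\<not> A \<subseteq> B" "\<not> B \<subseteq> A"
    using A B \<open>A \<noteq> B\<close> card_subset_eq by (metis clique_def)+
  then obtain a b where ab: "a \<in> A" "a \<notin> B" "b \<in> B" "b \<notin> A" by blast
  have ax: "{a, x} \<in> edges G" and bx: "{b, x} \<in> edges G"
    using A B ab x by (auto simp: clique_def)
  have nab: "{a, b} \<notin> edges G"
    using clique_neighbour_unique[OF B ab(2) x(2) ab(3) ax] x ab by blast
  have "a \<in> verts G" "b \<in> verts G" "a \<noteq> b" using A B ab by (auto simp: clique_def)
  from this nab show False
  proof (cases rule: new_edge_cases)
    case (bridge P Q)
    \<comment> \<open>A common vertex \<open>y\<close> of \<open>P\<close> and \<open>B\<close>
      would be a second neighbour of \<open>a\<close> in \<open>B\<close>. Stated for general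
      \<open>P\<close>, \<open>a\<close>, \<open>B\<close> since \<open>x\<close> misses
      \<open>P\<close> or \<open>Q\<close>, and the roles of \<open>a\<close>, \<open>b\<close> swap
      accordingly; the edge to \<open>x\<close> then completes a dumbbell in
      \<open>G\<close>.\<close>
    have *: "P \<inter> B = {}" if B: "clique G k B" "x \<in> B" "a \<notin> B" "{a, x} \<in> edges G"
      and P: "clique G k P" "a \<in> P" "x \<notin> P" for P a B
    proof (rule ccontr)
      assume "P \<inter> B \<noteq> {}"
      then obtain y where "y \<in> P" "y \<in> B" by blast
      moreover have "{a, y} \<in> edges G" using P B(3) calculation by (auto simp: clique_def)
      ultimately show False
        using clique_neighbour_unique[OF B(1,3,2) _ B(4)] P(3) by blast
    qed
    show False
    proof (cases "x \<in> P")
      case True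
      then have "x \<notin> Q" using bridge by blast
      then have "Q \<inter> A = {}" by (rule *[OF A x(1) ab(4) bx bridge(2,5)])
      then show False using no_dumbbell[OF bridge(2) A bridge(5) x(1) bx] by simp
    next
      case False
      then have "P \<inter> B = {}" by (rule *[OF B x(2) ab(2) ax bridge(1,4)])
      then show False using no_dumbbell[OF bridge(1) B bridge(4) x(2) ax] by simp
    qed
  next
    case (common P)
    \<comment> \<open>The vertex \<open>x\<close> is itself a common neighbour of \<open>a\<close>
      and \<open>b\<close>, which is why two are required. The other one gives the path
      \<open>a\<close>, \<open>y\<close>, \<open>b\<close>, \<open>x\<close> around
      \<open>A\<close>.\<close>
    then obtain y where y: "y \<noteq> x" "{a, y} \<in> edges G" "{b, y} \<in> edges G" by metis
    have "y \<notin> A" using clique_neighbour_unique[OF A ab(4) x(1) _ bx y(3)] y(1) by blast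
    then have "copies (cycle (k + 1)) G \<noteq> {}"
      using A x ab y bx k edge_verts[OF y(3)]
      by (intro cycle_of_clique_and_path[of G k A x a "[y, b]"]) (auto simp: insert_commute)
    then show False using cycle_free by simp
  qed
qed

text \<open>An uncovered \<open>u\<close> cannot end a bridge, so it shares neighbours with every
  non-neighbour in \<open>A\<close>. Two such non-neighbours \<open>a\<close>, \<open>b\<close> are
  thus joined by a path through \<open>u\<close> outside \<open>A\<close>.\<close>

lemma verts_covered_by_cliques:
  assumes A: "clique G k A" and u: "u \<in> verts G"
  shows "\<exists>P. clique G k P \<and> u \<in> P"
proof (rule ccontr)
  assume uncov: "\<not> ?thesis"
  then have uA: "u \<notin> A" using A by blast
  have common: "\<exists>q. q \<notin> A \<and> {u, q} \<in> edges G \<and> {a, q} \<in> edges G"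
    if a: "a \<in> A" "{u, a} \<notin> edges G" for a
  proof -
    have "a \<in> verts G" "u \<noteq> a" using A a uA by (auto simp: clique_def)
    from u this a(2) show ?thesis
    proof (cases rule: new_edge_cases)
      case (bridge P Q)
      then show ?thesis using uncov by blast
    next
      case (common P)
      \<comment> \<open>At most one of the two common neighbours lies in \<open>A\<close>, because
        both are adjacent to \<open>u\<close>.\<close>
      then show ?thesis using clique_neighbour_unique[OF A uA] by blast
    qed
  qed
  have "card {a \<in> A. {u, a} \<in> edges G} \<le> 1"
    using clique_neighbour_unique[OF A uA] A
    by (subst card_le_Suc0_iff_eq[unfolded One_nat_def[symmetric]]) (auto simp: clique_def)
  moreover have "card (A - {a \<in> A. {u, a} \<in> edges G}) = k - card {a \<in> A. {u, a} \<in> edges G}"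
    using A by (subst card_Diff_subset) (auto simp: clique_def)
  ultimately have "2 \<le> card (A - {a \<in> A. {u, a} \<in> edges G})" using k by linarith
  then obtain Y where "Y \<subseteq> A - {a \<in> A. {u, a} \<in> edges G}" "card Y = 2"
    by (meson obtain_subset_with_card_n)
  then obtain a b where ab: "a \<noteq> b" "a \<in> A" "b \<in> A" "{u, a} \<notin> edges G" "{u, b} \<notin> edges G"
    by (auto simp: card_2_iff)
  obtain p where p: "p \<notin> A" "{u, p} \<in> edges G" "{a, p} \<in> edges G" using common ab by blast
  obtain q where q: "q \<notin> A" "{u, q} \<in> edges G" "{b, q} \<in> edges G" using common ab by blast
  have "p \<noteq> q"
    using clique_neighbour_unique[OF A p(1) ab(2,3)] p q ab(1) by (auto simp: insert_commute)
  then have "copies (cycle (k + 1)) G \<noteq> {}"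
    \<comment> \<open>The detour \<open>b\<close>, \<open>q\<close>, \<open>u\<close>,
      \<open>p\<close>, \<open>a\<close> has three inner vertices, and 3 < k is exactly the bound
      \<open>k \<ge> 4\<close>.\<close>
    using A ab p q u uA k edge_verts[OF p(2)] edge_verts[OF q(2)]
    by (intro cycle_of_clique_and_path[of G k A a b "[q, u, p]"]) (auto simp: insert_commute)
  then show False using cycle_free by simp
qed

text \<open>A set of \<open>k\<close> vertices that is not a clique misses an edge, and either
  outcome of adding it exhibits a \<open>k\<close>-clique already in \<open>G\<close>.\<close>

lemma clique_exists:
  assumes "k \<le> card (verts G)"
  shows "\<exists>P. clique G k P"
proof (rule ccontr)
  assume none: "\<not> ?thesis"
  obtain P where P: "P \<subseteq> verts G" "card P = k" "finite P"
    using assms obtain_subset_with_card_n by metis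
  then obtain u v where uv: "u \<in> P" "v \<in> P" "u \<noteq> v" "{u, v} \<notin> edges G"
    using none by (auto simp: clique_def)
  then have "u \<in> verts G" "v \<in> verts G" using P by auto
  then show False using uv(3,4) none by (cases rule: new_edge_cases) auto
qed

lemma dvd_card_verts:
  assumes "k \<le> card (verts G)"
  shows "k dvd card (verts G)"
proof -
  have U: "\<Union> {P. clique G k P} = verts G"
    using clique_exists[OF assms] verts_covered_by_cliques by (auto simp: clique_def)
  have "finite (\<Union> {P. clique G k P})" using U finite_verts by simp
  then have "k * card {P. clique G k P} = card (\<Union> {P. clique G k P})"
    using cliques_disjoint
    by (intro card_partition) (auto simp: clique_def dest: finite_UnionD)
  then show ?thesis using U by (metis dvd_triv_left)
qed

end

section \<open>Disjoint unions of cliques\<close>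

text \<open>Quotients by \<open>k\<close> label the components, so lying in the same component
  becomes an equation.\<close>

definition clique_union :: "nat \<Rightarrow> nat \<Rightarrow> nat ugraph" where
  "clique_union k t =
    ({..<k * t}, {{x, y} | x y. x < k * t \<and> y < k * t \<and> x \<noteq> y \<and> x div k = y div k})"

lemma clique_union_edge_iff:
  "{x, y} \<in> edges (clique_union k t) \<longleftrightarrow> x < k * t \<and> y < k * t \<and> x \<noteq> y \<and> x div k = y div k"
  by (auto simp: clique_union_def doubleton_eq_iff)

lemma div_block_eq:
  fixes k c :: nat
  assumes "k > 0"
  shows "{x. x div k = c} = {c * k..<c * k + k}"
proof (intro set_eqI iffI)
  fix x assume "x \<in> {c * k..<c * k + k}"
  then show "x \<in> {x. x div k = c}" by (auto intro!: div_nat_eqI simp: algebra_simps)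
next
  fix x assume "x \<in> {x. x div k = c}"
  then show "x \<in> {c * k..<c * k + k}"
    using dividend_less_div_times[OF assms, of x] by (auto simp: add.commute)
qed

lemma card_div_block:
  fixes k c :: nat
  assumes "k > 0"
  shows "finite {x. x div k = c}" "card {x. x div k = c} = k"
  by (simp_all add: div_block_eq[OF assms])

text \<open>The quotient by \<open>k\<close> is constant along the cycle, which would place
  \<open>k + 1\<close> distinct vertices in a block of size \<open>k\<close>.\<close>

lemma clique_union_cycle_free:
  assumes "k \<ge> 2"
  shows "copies (cycle (k + 1)) (clique_union k t) = {}"
proof (rule ccontr)
  assume "copies (cycle (k + 1)) (clique_union k t) \<noteq> {}"
  moreover have "simple_graph (cycle (k + 1))" using assms by (intro simple_graph_cycle) simp
  ultimately obtain f where inj: "inj_on f {..<k + 1}"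
    and edge: "\<And>e. e \<in> edges (cycle (k + 1)) \<Longrightarrow> f ` e \<in> edges (clique_union k t)"
    by (auto simp: copies_nonempty_iff cycle_def)
  have const: "f i div k = f 0 div k" if "i < k + 1" for i
    using that
  proof (induction i)
    case (Suc i)
    have "{i, Suc i} \<in> edges (cycle (k + 1))"
      unfolding cycle_def snd_conv using Suc.prems by (intro CollectI exI[of _ i]) simp
    from edge[OF this] have "f i div k = f (Suc i) div k" by (simp add: clique_union_edge_iff)
    then show ?case using Suc by simp
  qed simp
  have "f ` {..<k + 1} \<subseteq> {x. x div k = f 0 div k}"
    by (intro image_subsetI CollectI const) simp
  then have "card (f ` {..<k + 1}) \<le> card {x. x div k = f 0 div k}"
    using card_div_block(1) assms by (intro card_mono) auto
  then have "card (f ` {..<k + 1}) \<le> k" using card_div_block(2) assms by simp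
  then show False using inj by (simp add: card_image)
qed

text \<open>Adjacency forces \<open>P\<close> into a single block, and the cardinalities
  agree.\<close>

lemma clique_union_clique:
  assumes "k > 0" "clique (clique_union k t) k P" "p \<in> P"
  shows "P = {x. x div k = p div k}"
proof (rule card_subset_eq)
  show "P \<subseteq> {x. x div k = p div k}"
    using assms(2,3) by (auto simp: clique_def clique_union_edge_iff)
qed (use assms card_div_block in \<open>auto simp: clique_def\<close>)

lemma clique_union_block:
  assumes "k > 0" "u < k * t"
  shows "clique (clique_union k t) k {x. x div k = u div k}"
proof -
  have "u div k < t" using assms by (simp add: less_mult_imp_div_less mult.commute)
  then have "x < k * t" if "x div k = u div k" for x
    using that assms(1) by (metis div_less_iff_less_mult mult.commute)
  then show ?thesis
    using card_div_block[OF assms(1)] unfolding clique_def clique_union_edge_iff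
    by (auto simp: clique_union_def)
qed

text \<open>A bridge in the graph would have both ends in one block, forcing the two cliques to
  coincide. A missing edge joins two different blocks, which are the required disjoint
  cliques.\<close>

lemma clique_union_saturated:
  assumes "k > 0"
  shows "saturated (dumbbell k) (clique_union k t)"
  unfolding saturated_def
proof (intro conjI ballI impI)
  let ?G = "clique_union k t"
  show "simple_graph ?G" by (auto simp: simple_graph_def clique_union_def card_2_iff)
  show "copies (dumbbell k) ?G = {}"
  proof (rule ccontr)
    assume "copies (dumbbell k) ?G \<noteq> {}"
    then obtain P Q p q where PQ: "clique ?G k P" "clique ?G k Q" "P \<inter> Q = {}" "p \<in> P" "q \<in> Q"
      "{p, q} \<in> edges ?G"
      using assms dumbbell_copies_iff[of k ?G] by auto
    then have "P = Q"
      using clique_union_clique[OF assms] by (metis clique_union_edge_iff)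
    then show False using PQ by blast
  qed
  fix u v assume uv: "u \<in> verts ?G" "v \<in> verts ?G" "u \<noteq> v \<and> {u, v} \<notin> edges ?G"
  then have lt: "u < k * t" "v < k * t" by (auto simp: clique_union_def)
  then have ne: "u div k \<noteq> v div k" using uv by (auto simp: clique_union_edge_iff)
  have "clique (add_edge u v ?G) k P" if "clique ?G k P" for P
    using that by (auto simp: clique_def add_edge_def)
  then have "clique (add_edge u v ?G) k {x. x div k = u div k}"
    "clique (add_edge u v ?G) k {x. x div k = v div k}"
    using clique_union_block[OF assms] lt by auto
  moreover have "{x. x div k = u div k} \<inter> {x. x div k = v div k} = {}" using ne by auto
  moreover have "{u, v} \<in> edges (add_edge u v ?G)" by (simp add: add_edge_def)
  ultimately show "copies (dumbbell k) (add_edge u v ?G) \<noteq> {}"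
    unfolding dumbbell_copies_iff[OF assms] by blast
qed

section \<open>Vertex counts with and without a forced cycle\<close>

theorem theorem1p10:
  fixes r :: nat
  assumes "r \<ge> 5"
  shows "\<exists>F :: nat ugraph. simple_graph F \<and>
           infinite {n. sat n (cycle r) F = 0} \<and> infinite {n. sat n (cycle r) F > 0}"
proof -
  define k where "k = r - 1"
  have k: "k \<ge> 4" and r: "r = k + 1" using assms by (auto simp: k_def)
  have zero: "sat (k * t) (cycle r) (dumbbell k) = 0" for t
  proof -
    have "saturated (dumbbell k) (clique_union k t)" using clique_union_saturated k by simp
    moreover have "card (copies (cycle r) (clique_union k t)) = 0"
      using clique_union_cycle_free k r by simp
    moreover have "card (verts (clique_union k t)) = k * t" by (simp add: clique_union_def)
    ultimately have "0 \<in> {card (copies (cycle r) G) | G :: nat ugraph.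
        saturated (dumbbell k) G \<and> card (verts G) = k * t}"
      by (metis (mono_tags, lifting) mem_Collect_eq)
    then have "sat (k * t) (cycle r) (dumbbell k) \<le> 0"
      unfolding sat_def by (rule wellorder_Inf_le1)
    then show ?thesis by simp
  qed
  \<comment> \<open>\<open>Suc t\<close> rather than \<open>t\<close> ensures at least
    \<open>k\<close> vertices, as \<open>dvd_card_verts\<close> demands; the summand 1 breaks
    divisibility by \<open>k\<close>.\<close>
  have pos: "sat (k * Suc t + 1) (cycle r) (dumbbell k) > 0" for t
  proof (rule ccontr)
    let ?n = "k * Suc t + 1"
    assume "\<not> ?thesis"
    moreover have "edges (dumbbell k) \<noteq> {}" by (simp add: dumbbell_def)
    \<comment> \<open>An infimum of 0 could come from an empty set of values; attainment yields an
      actual saturated graph.\<close>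
    ultimately obtain G :: "nat ugraph" where G: "saturated (dumbbell k) G"
      "card (verts G) = ?n" "card (copies (cycle r) G) = 0"
      using sat_attained[of "dumbbell k" ?n "cycle r"] by auto
    then have "copies (cycle (k + 1)) G = {}"
      using finite_copies r by (metis card_0_eq saturated_def)
    then interpret cycle_free_saturated G k using k G by unfold_locales
    have "k dvd ?n" using dvd_card_verts G(2) by simp
    then have "k dvd 1" by (metis dvd_add_right_iff dvd_triv_left)
    then show False using k by simp
  qed
  have "range (\<lambda>t. k * t) \<subseteq> {n. sat n (cycle r) (dumbbell k) = 0}" using zero by auto
  moreover have "infinite (range (\<lambda>t. k * t))"
    using k by (subst finite_image_iff) (auto simp: inj_on_def)
  moreover have "range (\<lambda>t. k * Suc t + 1) \<subseteq> {n. sat n (cycle r) (dumbbell k) > 0}"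
    using pos by auto
  moreover have "infinite (range (\<lambda>t. k * Suc t + 1))"
    using k by (subst finite_image_iff) (auto simp: inj_on_def)
  moreover have "simple_graph (dumbbell k)" using simple_graph_dumbbell k by simp
  ultimately show ?thesis by (meson infinite_super)
qed

end
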